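(* Let $n,m\ge1$ and $1\le k<n$ be integers. For every $\varepsilon>0$, there exists an $\varepsilon$-differentially private randomized selection rule (selecting $k$ of $n$ candidates from review matrices in $[0,1]^{n\times m}$) that is not $L$-smooth with respect to $\|\cdot\|_{1,1}$ for any finite $L$.
   Context: A randomized selection rule $M$ maps each review matrix $X\in[0,1]^{n\times m}$ to a probability distribution on the size-$k$ subsets of $[n]=\{1,\dots,n\}$. Its marginal selection probabilities are $p_i(X)=\Pr[i\in M(X)]$. $M$ is $\varepsilon$-differentially private if for all $X,X'\in[0,1]^{n\times m}$ differing in at most one entry and every size-$k$ subset $S$, $\Pr[M(X)=S]\le e^{\varepsilon}\Pr[M(X')=S]$. $M$ is $L$-smooth if $\|p(X)-p(X')\|_1\le L\|X-X'\|_{1,1}$ for all $X,X'\in[0,1]^{n\times m}$, where $\|A\|_{1,1}=\sum_{i,j}|A_{i,j}|$. *)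

theory Defs
  imports "HOL-Probability.Probability"
begin

text \<open>
  An n-by-m matrix has type \<^typ>\<open>real^'m^'n\<close>: rows are indexed by the candidates \<open>'n\<close>,
  columns by \<open>'m\<close>. So n and m are \<open>CARD('n)\<close> and \<open>CARD('m)\<close>, both at least 1.
\<close>

definition review_matrices :: "(real^'m::finite^'n::finite) set" where
  "review_matrices = {X. \<forall>i j. X $ i $ j \<in> {0..1}}"

text \<open>Rules are total functions on the matrix type; only their values on
  \<^const>\<open>review_matrices\<close> are constrained or referred to.\<close>

definition selection_rule ::
    "nat \<Rightarrow> (real^'m::finite^'n::finite \<Rightarrow> 'n set pmf) \<Rightarrow> bool" where
  "selection_rule k M \<longleftrightarrow>
     (\<forall>X\<in>review_matrices. set_pmf (M X) \<subseteq> {S. card S = k})"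

definition marginal ::
    "(real^'m::finite^'n::finite \<Rightarrow> 'n set pmf) \<Rightarrow> real^'m^'n \<Rightarrow> real^'n" where
  "marginal M X = (\<chi> i. measure_pmf.prob (M X) {S. i \<in> S})"

definition l1_norm :: "real^'n::finite \<Rightarrow> real" where
  "l1_norm v = (\<Sum>i\<in>UNIV. \<bar>v $ i\<bar>)"

definition entrywise_l1_norm :: "real^'m::finite^'n::finite \<Rightarrow> real" where
  "entrywise_l1_norm A = (\<Sum>i\<in>UNIV. \<Sum>j\<in>UNIV. \<bar>A $ i $ j\<bar>)"

definition differ_in_at_most_one_entry ::
    "real^'m::finite^'n::finite \<Rightarrow> real^'m^'n \<Rightarrow> bool" where
  "differ_in_at_most_one_entry X X' \<longleftrightarrow> card {(i, j). X $ i $ j \<noteq> X' $ i $ j} \<le> 1"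

definition differentially_private ::
    "nat \<Rightarrow> real \<Rightarrow> (real^'m::finite^'n::finite \<Rightarrow> 'n set pmf) \<Rightarrow> bool" where
  "differentially_private k \<epsilon> M \<longleftrightarrow>
     (\<forall>X\<in>review_matrices. \<forall>X'\<in>review_matrices. differ_in_at_most_one_entry X X' \<longrightarrow>
        (\<forall>S. card S = k \<longrightarrow> pmf (M X) S \<le> exp \<epsilon> * pmf (M X') S))"

definition smooth ::
    "real \<Rightarrow> (real^'m::finite^'n::finite \<Rightarrow> 'n set pmf) \<Rightarrow> bool" where
  "smooth L M \<longleftrightarrow>
     (\<forall>X\<in>review_matrices. \<forall>X'\<in>review_matrices.
        l1_norm (marginal M X - marginal M X') \<le> L * entrywise_l1_norm (X - X'))"

end

theory Submission
  imports Defs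
begin

text \<open>
  Differential privacy bounds the effect of an arbitrarily small change of an entry by a constant,
  not by the size of the change. So a rule that mixes two distinct selections may let the
  mixing weight jump at the value 0 of a single entry, between \<open>1/2\<close> and \<open>1 - exp (-\<epsilon>) / 2\<close>:
  both weights and both complementary weights differ by a factor of at most \<open>exp \<epsilon>\<close>, but the
  marginals are discontinuous.
\<close>

definition two_point_pmf :: "'a \<Rightarrow> 'a \<Rightarrow> real \<Rightarrow> 'a pmf" where
  "two_point_pmf a b q = map_pmf (\<lambda>c. if c then a else b) (bernoulli_pmf q)"

lemma set_two_point_pmf_subset: "set_pmf (two_point_pmf a b q) \<subseteq> {a, b}"
  by (auto simp: two_point_pmf_def)

lemma measure_two_point_pmf:
  assumes "0 \<le> q" "q \<le> 1"
  shows "measure_pmf.prob (two_point_pmf a b q) E = q * indicator E a + (1 - q) * indicator E b"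
proof -
  have "measure_pmf.prob (two_point_pmf a b q) E =
      measure_pmf.expectation (two_point_pmf a b q) (indicator E)"
    by simp
  also have "\<dots> = q * indicator E a + (1 - q) * indicator E b"
    using assms unfolding two_point_pmf_def integral_map_pmf by (subst integral_bernoulli_pmf) auto
  finally show ?thesis .
qed

text \<open>The mass at \<open>x\<close> is a combination of the two weights with coefficients 0 or
  1, so bounds on the weights add up to a bound on the mass, also when \<open>a = b\<close>.\<close>

lemma pmf_two_point_pmf_le:
  assumes "0 \<le> q" "q \<le> 1" "0 \<le> r" "r \<le> 1" "q \<le> c * r" "1 - q \<le> c * (1 - r)"
  shows "pmf (two_point_pmf a b q) x \<le> c * pmf (two_point_pmf a b r) x"
proof -
  have "q * indicator {x} a \<le> c * r * indicator {x} a"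
    and "(1 - q) * indicator {x} b \<le> c * (1 - r) * indicator {x} b"
    using assms by (auto simp: indicator_def)
  then show ?thesis
    using assms by (simp add: measure_two_point_pmf algebra_simps flip: measure_pmf_single)
qed

text \<open>Mixing two such sets makes the marginal of \<open>a\<close> equal to the weight of
  \<open>A\<close>. The bound \<open>k < CARD('n)\<close> leaves room to avoid \<open>a\<close>, and
  \<open>1 \<le> k\<close> leaves room to contain it.\<close>

lemma obtain_sets_of_card_separated_by_element:
  assumes "1 \<le> k" and "k < CARD('n::finite)"
  obtains A B :: "'n::finite set" and a where "card A = k" "card B = k" "a \<in> A" "a \<notin> B"
proof -
  fix a :: 'n
  have card: "card (UNIV - {a}) = CARD('n) - 1"
    by (simp add: card_Diff_singleton)
  have "k \<le> card (UNIV - {a})" "k - 1 \<le> card (UNIV - {a})"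
    using card assms by linarith+
  then obtain B C where B: "B \<subseteq> UNIV - {a}" "card B = k"
    and C: "C \<subseteq> UNIV - {a}" "card C = k - 1"
    by (metis obtain_subset_with_card_n)
  have "card (insert a C) = k"
    using C assms by (subst card_insert_disjoint) auto
  then show thesis
    using that[of "insert a C" B a] B by auto
qed

lemma marginal_diff_le_l1_norm:
  "\<bar>marginal M X $ i - marginal M X' $ i\<bar> \<le> l1_norm (marginal M X - marginal M X')"
  unfolding l1_norm_def using member_le_sum[of i UNIV "\<lambda>i. \<bar>(marginal M X - marginal M X') $ i\<bar>"]
  by simp

lemma entrywise_l1_norm_single_entry:
  "entrywise_l1_norm (\<chi> i j. if i = i0 \<and> j = j0 then x else 0) = \<bar>x\<bar>"
proof -
  have "(\<Sum>j\<in>UNIV. \<bar>if i = i0 \<and> j = j0 then x else 0\<bar>) = (if i = i0 then \<bar>x\<bar> else 0)" for i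
    by (simp add: if_distrib[of abs] cong: if_cong)
  then show ?thesis
    by (simp add: entrywise_l1_norm_def)
qed

text \<open>The single-entry matrix has distance \<open>x\<close> from 0, so smoothness would force
  \<open>d \<le> L * x\<close> for arbitrarily small positive \<open>x\<close>.\<close>

lemma not_smooth_if_marginal_jumps:
  fixes M :: "real^'m::finite^'n::finite \<Rightarrow> 'n set pmf"
  assumes "d > 0"
    and jump: "\<And>x. 0 < x \<Longrightarrow> x \<le> 1 \<Longrightarrow>
      d \<le> \<bar>marginal M (\<chi> i j. if i = i0 \<and> j = j0 then x else 0) $ a - marginal M 0 $ a\<bar>"
  shows "\<not> smooth L M"
proof
  assume smooth: "smooth L M"
  have le: "d \<le> L * x" if x: "0 < x" "x \<le> 1" for x
  proof -
    let ?X = "\<chi> i j. if i = i0 \<and> j = j0 then x else 0"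
    have "?X \<in> review_matrices" "0 \<in> (review_matrices :: (real^'m^'n) set)"
      using x by (auto simp: review_matrices_def)
    then have "l1_norm (marginal M ?X - marginal M 0) \<le> L * entrywise_l1_norm (?X - 0)"
      using smooth unfolding smooth_def by blast
    also have "\<dots> = L * x"
      using x by (simp add: entrywise_l1_norm_single_entry)
    finally show ?thesis
      using jump[OF x] marginal_diff_le_l1_norm[of M ?X a 0] by linarith
  qed
  \<comment> \<open>The cap 1 keeps the matrix in \<open>review_matrices\<close>; the other bound
    gives \<open>L * x < d\<close>. Adding 1 to \<open>\<bar>L\<bar>\<close> keeps the denominator
    positive when \<open>L = 0\<close>.\<close>
  define x where "x = min 1 (d / (2 * (\<bar>L\<bar> + 1)))"
  have "x \<le> d / (2 * (\<bar>L\<bar> + 1))"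
    by (simp add: x_def)
  then have "x * (2 * (\<bar>L\<bar> + 1)) \<le> d"
    by (subst (asm) pos_le_divide_eq) auto
  moreover have "0 < x" "x \<le> 1"
    using \<open>d > 0\<close> by (auto simp: x_def)
  moreover from this have "L * x \<le> \<bar>L\<bar> * x"
    by (intro mult_right_mono) auto
  moreover have "x * (2 * (\<bar>L\<bar> + 1)) = 2 * (\<bar>L\<bar> * x) + 2 * x"
    by (simp add: algebra_simps)
  ultimately show False
    using le[of x] \<open>d > 0\<close> by linarith
qed

theorem proposition2:
  fixes k :: nat and \<epsilon> :: real
  assumes "1 \<le> k" and "k < CARD('n::finite)" and "\<epsilon> > 0"
  shows "\<exists>M :: real^'m::finite^'n \<Rightarrow> 'n set pmf.
           selection_rule k M \<and> differentially_private k \<epsilon> M \<and> (\<forall>L::real. \<not> smooth L M)"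
proof -
  obtain A B :: "'n set" and a where AB: "card A = k" "card B = k" "a \<in> A" "a \<notin> B"
    using obtain_sets_of_card_separated_by_element assms by blast
  fix i0 :: 'n and j0 :: 'm
  define t where "t = exp (- \<epsilon>)"
  have t: "0 < t" "t < 1" and exp: "exp \<epsilon> = 1 / t"
    using assms by (auto simp: t_def exp_minus field_simps)
  \<comment> \<open>The complementary weight drops from \<open>1 / 2\<close> to
    \<open>t / 2\<close>, exactly the factor \<open>exp \<epsilon>\<close> that privacy
    allows.\<close>
  define q :: "real^'m^'n \<Rightarrow> real"
    where "q X = (if X $ i0 $ j0 = 0 then 1 / 2 else 1 - t / 2)" for X
  define M where "M X = two_point_pmf A B (q X)" for X
  have q: "0 \<le> q X" "q X \<le> 1" for X
    using t by (auto simp: q_def)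
  \<comment> \<open>The weight of \<open>A\<close> grows by the factor \<open>2 - t\<close>, and
    this square shows that \<open>2 - t \<le> 1 / t = exp \<epsilon>\<close>.\<close>
  have "(1 - t) * (1 - t) \<ge> 0"
    by simp
  then have "t * (2 - t) \<le> 1"
    by (simp add: algebra_simps)
  moreover have "t * t \<le> 1"
    using t by (simp add: mult_le_one)
  ultimately have "q X \<le> exp \<epsilon> * q Y" "1 - q X \<le> exp \<epsilon> * (1 - q Y)" for X Y
    using t by (auto simp: exp q_def field_simps)
  then have "differentially_private k \<epsilon> M"
    using q by (auto simp: differentially_private_def M_def intro!: pmf_two_point_pmf_le)
  moreover have "selection_rule k M"
    using set_two_point_pmf_subset[of A B] AB by (fastforce simp: selection_rule_def M_def)
  moreover have "\<not> smooth L M" for L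
  proof (rule not_smooth_if_marginal_jumps)
    have "marginal M X $ a = q X" for X
      using AB q[of X] by (simp add: marginal_def M_def measure_two_point_pmf)
    \<comment> \<open>The jump is exactly \<open>(1 - t / 2) - 1 / 2\<close>, whatever the size of
      \<open>x > 0\<close>.\<close>
    then show "(1 - t) / 2 \<le>
        \<bar>marginal M (\<chi> i j. if i = i0 \<and> j = j0 then x else 0) $ a - marginal M 0 $ a\<bar>"
      if "0 < x" for x
      using that t by (simp add: q_def field_simps)
  qed (use t in simp)
  ultimately show ?thesis
    by blast
qed

end
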